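(* Let $m\ge 1$ and let the edges of the complete bipartite graph $K_{2m-1,2m-1}$ be coloured $2$-locally. Then there is a monochromatic path on $2m$ vertices in $K_{2m-1,2m-1}$.
   Context: An edge colouring is an arbitrary assignment of colours to edges (it need not be proper), and the total number of colours used is not restricted. An edge colouring of a graph is $2$-local if every vertex is incident to edges of at most $2$ distinct colours. A path is monochromatic if all its edges have the same colour. *)

theory Defs
  imports Main
begin

(* A simple graph is a vertex set V together with a set E of two-element subsets of V.
   An edge colouring is a function c :: 'a set \<Rightarrow> 'c with no properness condition; only its
   values on E are relevant, and the colour type 'c is arbitrary. *)

definition complete_bipartite :: "nat \<Rightarrow> nat \<Rightarrow> 'a set \<Rightarrow> 'a set set \<Rightarrow> bool" where
  "complete_bipartite p q V E \<longleftrightarrow>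
     (\<exists>A B. finite A \<and> finite B \<and> card A = p \<and> card B = q \<and> A \<inter> B = {} \<and>
            V = A \<union> B \<and> E = {{a, b} |a b. a \<in> A \<and> b \<in> B})"

(* The finiteness conjunct is needed because card is 0 on infinite sets. *)
definition local_colouring :: "nat \<Rightarrow> 'a set \<Rightarrow> 'a set set \<Rightarrow> ('a set \<Rightarrow> 'c) \<Rightarrow> bool" where
  "local_colouring k V E c \<longleftrightarrow>
     (\<forall>v\<in>V. finite (c ` {e \<in> E. v \<in> e}) \<and> card (c ` {e \<in> E. v \<in> e}) \<le> k)"

definition path_edges :: "'a list \<Rightarrow> 'a set set" where
  "path_edges xs = {{xs ! i, xs ! Suc i} |i. Suc i < length xs}"

(* A path is given by the list of its vertices, so its number of vertices is the list length. *)
definition is_path :: "'a set \<Rightarrow> 'a set set \<Rightarrow> 'a list \<Rightarrow> bool" where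
  "is_path V E xs \<longleftrightarrow> xs \<noteq> [] \<and> distinct xs \<and> set xs \<subseteq> V \<and> path_edges xs \<subseteq> E"

definition monochromatic_path :: "'a set \<Rightarrow> 'a set set \<Rightarrow> ('a set \<Rightarrow> 'c) \<Rightarrow> 'a list \<Rightarrow> bool" where
  "monochromatic_path V E c xs \<longleftrightarrow>
     is_path V E xs \<and> (\<forall>e\<in>path_edges xs. \<forall>f\<in>path_edges xs. c e = c f)"

end

theory Submission
  imports Defs
begin

text \<open>Colours that never meet at a vertex can be identified without creating new monochromatic
  paths. The colour sets at vertices of opposite classes intersect, so after such identifications
  either at most three colours remain, or there are exactly four colours \<open>w, x, y, z\<close> and all
  vertices of one class have colour set \<open>{w, x}\<close> or \<open>{y, z}\<close>; then two pigeonhole steps give a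
  monochromatic \<open>K\<^bsub>m,m\<^esub>\<close>.

  With three colours, split both classes into blocks according to a missing colour: edges between
  blocks of different index have the third colour. If all blocks have size less than \<open>m\<close>, the
  complete bipartite graphs at the largest block suffice, joined through the edges between this block
  and its counterpart. If some block has size at least \<open>m\<close>, remove two vertices of each class and
  prolong the path given by induction on \<open>m\<close>; the remaining cases have two colours and are settled
  by depth-first search.\<close>

section \<open>Paths in bipartite graphs\<close>

definition link :: "'a set \<Rightarrow> 'a set \<Rightarrow> 'a \<Rightarrow> 'a \<Rightarrow> bool" where
  "link A B u v \<longleftrightarrow> u \<in> A \<and> v \<in> B \<or> u \<in> B \<and> v \<in> A"

text \<open>The relation is arbitrary, so that single colours, complements of colours and merged
  colours are treated alike. Lists with at most one vertex count as paths.\<close>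

definition rpath :: "('a \<Rightarrow> 'a \<Rightarrow> bool) \<Rightarrow> 'a list \<Rightarrow> bool" where
  "rpath R xs \<longleftrightarrow> distinct xs \<and> successively R xs"

lemma link_swap: "link A B = link B A"
  by (auto simp: link_def fun_eq_iff)

lemma link_sym: "link A B u v \<Longrightarrow> link A B v u"
  by (auto simp: link_def)

lemma successively_cong_on:
  assumes "successively P xs" "\<And>x y. x \<in> set xs \<Longrightarrow> y \<in> set xs \<Longrightarrow> P x y \<Longrightarrow> Q x y"
  shows "successively Q xs"
  using assms by (induction P xs rule: successively.induct) auto

lemma rpath_mono:
  assumes "rpath P xs" "\<And>x y. x \<in> set xs \<Longrightarrow> y \<in> set xs \<Longrightarrow> P x y \<Longrightarrow> Q x y"
  shows "rpath Q xs"
  using assms successively_cong_on unfolding rpath_def by metis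

lemma rpath_rev:
  assumes "rpath R xs" "symp R"
  shows "rpath R (rev xs)"
proof -
  have "successively (\<lambda>x y. R y x) xs"
    using assms by (auto simp: rpath_def symp_def intro: successively_cong_on)
  then show ?thesis using assms(1) by (simp add: rpath_def)
qed

lemma rpath_take:
  assumes "rpath R xs"
  shows "rpath R (take n xs)"
proof -
  have "successively R (take n xs @ drop n xs)"
    using assms by (simp add: rpath_def)
  then have "successively R (take n xs)"
    unfolding successively_append_iff by blast
  then show ?thesis using assms by (simp add: rpath_def)
qed

lemma rpath_append:
  assumes "rpath R xs" "rpath R ys" "set xs \<inter> set ys = {}"
    and "xs \<noteq> [] \<Longrightarrow> ys \<noteq> [] \<Longrightarrow> R (last xs) (hd ys)"
  shows "rpath R (xs @ ys)"
  using assms by (auto simp: rpath_def successively_append_iff)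

text \<open>Every vertex lies on an edge. A single vertex would satisfy \<open>successively\<close>
  vacuously, hence the bound on the length.\<close>

lemma successively_link_subset:
  assumes "successively (link A B) xs" "length xs \<ge> 2"
  shows "set xs \<subseteq> A \<union> B"
proof
  fix x assume "x \<in> set xs"
  then obtain i where i: "i < length xs" "x = xs ! i"
    by (auto simp: in_set_conv_nth)
  have *: "link A B (xs ! j) (xs ! Suc j)" if "Suc j < length xs" for j
    using assms(1) that by (auto simp: successively_conv_nth)
  show "x \<in> A \<union> B"
  proof (cases i)
    case 0
    then show ?thesis using *[of 0] assms(2) i by (auto simp: link_def)
  next
    case (Suc j)
    then show ?thesis using *[of j] i by (auto simp: link_def)
  qed
qed

lemma link_path_balanced:
  assumes "rpath (link A B) xs" "A \<inter> B = {}" "length xs = 2 * k"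
  shows "card (set xs \<inter> A) = k \<and> card (set xs \<inter> B) = k"
  using assms
proof (induction k arbitrary: xs)
  case 0
  then show ?case by simp
next
  case (Suc k)
  then obtain u v ys where xs: "xs = u # v # ys"
    by (auto simp: length_Suc_conv)
  have "rpath (link A B) ys"
    using Suc.prems(1) by (auto simp: rpath_def xs successively_Cons)
  with Suc xs have IH: "card (set ys \<inter> A) = k" "card (set ys \<inter> B) = k" by auto
  have uv: "link A B u v" "u \<notin> set ys" "v \<notin> set ys" "u \<noteq> v"
    using Suc.prems(1) by (auto simp: rpath_def xs)
  show ?case
  proof (cases "u \<in> A")
    case True
    then have "set xs \<inter> A = insert u (set ys \<inter> A)" "set xs \<inter> B = insert v (set ys \<inter> B)"
      using uv Suc.prems(2) by (auto simp: xs link_def)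
    then show ?thesis using IH uv by simp
  next
    case False
    then have "set xs \<inter> A = insert v (set ys \<inter> A)" "set xs \<inter> B = insert u (set ys \<inter> B)"
      using uv Suc.prems(2) by (auto simp: xs link_def)
    then show ?thesis using IH uv by simp
  qed
qed

lemma link_path_last:
  assumes "successively (link A B) xs" "A \<inter> B = {}" "length xs = 2 * k" "k \<ge> 1" "hd xs \<in> A"
  shows "last xs \<in> B"
  using assms
proof (induction k arbitrary: xs)
  case 0
  then show ?case by simp
next
  case (Suc k)
  then obtain u v ys where xs: "xs = u # v # ys"
    by (auto simp: length_Suc_conv)
  show ?case
  proof (cases "ys = []")
    case True
    then show ?thesis using Suc.prems by (auto simp: xs link_def)
  next
    case False
    then have "k \<ge> 1" using Suc.prems(3) xs by (cases k) auto
    moreover have "successively (link A B) ys" "hd ys \<in> A" "length ys = 2 * k"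
      using Suc.prems False by (auto simp: xs successively_Cons link_def)
    ultimately show ?thesis using Suc.IH[of ys] Suc.prems(2) False xs by simp
  qed
qed

text \<open>Removing one vertex of each side leaves a graph of the same kind. The first vertex is
  prescribed so that the path can be glued to another one there.\<close>

lemma complete_bipartite_path:
  assumes "finite X" "finite Y" "X \<inter> Y = {}" "\<And>x y. x \<in> X \<Longrightarrow> y \<in> Y \<Longrightarrow> R x y \<and> R y x"
    and "x \<in> X" "1 \<le> d" "d \<le> card X" "d \<le> card Y"
  shows "\<exists>xs. length xs = 2 * d \<and> rpath R xs \<and> hd xs = x \<and> set xs \<subseteq> X \<union> Y"
  using assms
proof (induction d arbitrary: X Y x)
  case 0
  then show ?case by simp
next
  case (Suc d)
  then obtain y where y: "y \<in> Y" by fastforce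
  show ?case
  proof (cases "d = 0")
    case True
    then show ?thesis using Suc.prems y
      by (intro exI[of _ "[x, y]"]) (auto simp: rpath_def)
  next
    case False
    have c: "d \<le> card (X - {x})" "d \<le> card (Y - {y})"
      using Suc.prems y by auto
    then have "X - {x} \<noteq> {}" using False by (metis card.empty le_zero_eq)
    then obtain x' where x': "x' \<in> X - {x}" by blast
    have "\<exists>xs. length xs = 2 * d \<and> rpath R xs \<and> hd xs = x' \<and> set xs \<subseteq> (X - {x}) \<union> (Y - {y})"
      using Suc.prems c x' False by (intro Suc.IH) auto
    then obtain xs where xs: "length xs = 2 * d" "rpath R xs" "hd xs = x'"
      "set xs \<subseteq> (X - {x}) \<union> (Y - {y})" by blast
    have "rpath R (x # y # xs)"
      using xs Suc.prems y x' by (auto simp: rpath_def successively_Cons)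
    then show ?thesis using xs Suc.prems y
      by (intro exI[of _ "x # y # xs"]) auto
  qed
qed

text \<open>Agreement of consecutive edges propagates along the path. The condition concerns one
  vertex \<open>v\<close> at a time and can be checked from the few colours present there.\<close>

lemma successively_equal_colour:
  assumes "rpath R xs" "length xs \<ge> 2"
    and "\<And>u v w. R u v \<Longrightarrow> R v w \<Longrightarrow> c {u, v} = c {v, w}"
  shows "\<exists>r. rpath (\<lambda>u v. R u v \<and> c {u, v} = r) xs"
proof -
  have R: "R (xs ! i) (xs ! Suc i)" if "Suc i < length xs" for i
    using assms(1) that by (auto simp: rpath_def successively_conv_nth)
  have "c {xs ! i, xs ! Suc i} = c {xs ! 0, xs ! Suc 0}" if "Suc i < length xs" for i
    using that
  proof (induction i)
    case (Suc i)
    then show ?case using assms(3)[OF R[of i] R[of "Suc i"]] by simp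
  qed simp
  then obtain r where "c {xs ! i, xs ! Suc i} = r" if "Suc i < length xs" for i
    by meson
  then have "successively (\<lambda>u v. R u v \<and> c {u, v} = r) xs"
    unfolding successively_conv_nth using R by blast
  then show ?thesis using assms(1) unfolding rpath_def by blast
qed

section \<open>Two colours\<close>

text \<open>The configurations of a depth-first search: \<open>S\<close> holds the finished vertices, \<open>T\<close> the
  untouched ones and \<open>U\<close> is the stack. Every step lowers \<open>card T - card S\<close> by one.\<close>

lemma dfs_state:
  assumes "finite V" "symp R" "k \<le> card V"
  shows "\<exists>S T U. S \<union> T \<union> set U = V \<and> S \<inter> T = {} \<and> (S \<union> T) \<inter> set U = {} \<and> rpath R U \<and>
    (\<forall>x\<in>S. \<forall>y\<in>T. \<not> R x y) \<and> card T + k = card S + card V"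
  using assms(3)
proof (induction k)
  case 0
  then show ?case
    by (intro exI[of _ "{}"] exI[of _ V] exI[of _ "[]"]) (auto simp: rpath_def)
next
  case (Suc k)
  then obtain S T U where st: "S \<union> T \<union> set U = V" "S \<inter> T = {}" "(S \<union> T) \<inter> set U = {}" "rpath R U"
    "\<forall>x\<in>S. \<forall>y\<in>T. \<not> R x y" "card T + k = card S + card V" by auto
  have fin: "finite S" "finite T" using st(1) assms(1) by (auto dest: finite_subset[rotated])
  have "T \<noteq> {}" using st(6) Suc.prems by auto
  have push: ?case if t: "t \<in> T" "U \<noteq> [] \<Longrightarrow> R t (hd U)" for t
  proof (intro exI conjI)
    show "S \<union> (T - {t}) \<union> set (t # U) = V" using st(1) t by auto
    show "rpath R (t # U)" using st(3,4) t by (cases U) (auto simp: rpath_def)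
    show "card (T - {t}) + Suc k = card S + card V"
      using st(6) t fin by (simp add: card_Diff_singleton) (metis Suc_pred add_Suc card_gt_0_iff empty_iff)
  qed (use st t in auto)
  \<comment> \<open>If the stack is empty, any untouched vertex is pushed; if its top
    \<open>u\<close> has an untouched neighbour, that one is pushed; otherwise \<open>u\<close> is
    finished.\<close>
  show ?case
  proof (cases U)
    case Nil
    then show ?thesis using push \<open>T \<noteq> {}\<close> by blast
  next
    case (Cons u us)
    show ?thesis
    proof (cases "\<exists>t\<in>T. R t u")
      case True
      then show ?thesis using push Cons by auto
    next
      case False
      show ?thesis
      proof (intro exI conjI)
        show "insert u S \<union> T \<union> set us = V" using st(1) Cons by auto
        show "\<forall>x\<in>insert u S. \<forall>y\<in>T. \<not> R x y"
          using st(5) False assms(2) by (auto simp: symp_def)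
        show "rpath R us" using st(4) Cons by (auto simp: rpath_def successively_Cons)
        show "card T + Suc k = card (insert u S) + card V"
          using st fin Cons by auto
      qed (use st Cons in \<open>auto simp: rpath_def\<close>)
    qed
  qed
qed

lemma rpath_join:
  assumes "rpath R xs" "rpath R ys" "symp R" "set xs \<inter> set ys = {}" "R (hd xs) (hd ys)"
  shows "rpath R (rev xs @ ys)"
  using assms by (intro rpath_append) (auto simp: rpath_rev last_rev)

lemma rpath_take_exact:
  assumes "rpath R xs" "n \<le> length xs"
  shows "\<exists>xs. length xs = n \<and> rpath R xs"
  using assms rpath_take by (intro exI[of _ "take n xs"]) auto

text \<open>Each complete bipartite graph contributes a path starting at its end of the edge between
  \<open>x\<close> and \<open>x'\<close>. The edge joins them, and the result is cut to
  \<open>n\<close> vertices.\<close>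

lemma joined_complete_bipartite_path:
  assumes "symp R" "finite X" "finite Y" "finite X'" "finite Y'" "X \<inter> Y = {}" "X' \<inter> Y' = {}"
    and "(X \<union> Y) \<inter> (X' \<union> Y') = {}"
    and "\<And>x y. x \<in> X \<Longrightarrow> y \<in> Y \<Longrightarrow> R x y" "\<And>x y. x \<in> X' \<Longrightarrow> y \<in> Y' \<Longrightarrow> R x y"
    and "x \<in> X" "x' \<in> X'" "R x x'"
    and "1 \<le> d" "d \<le> card X" "d \<le> card Y" "1 \<le> d'" "d' \<le> card X'" "d' \<le> card Y'"
    and "n \<le> 2 * (d + d')"
  shows "\<exists>xs. length xs = n \<and> rpath R xs"
proof -
  have R: "R x y \<and> R y x" if "x \<in> X \<and> y \<in> Y \<or> x \<in> X' \<and> y \<in> Y'" for x y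
    using that assms(1,9,10) by (auto simp: symp_def)
  obtain xs where xs: "length xs = 2 * d" "rpath R xs" "hd xs = x" "set xs \<subseteq> X \<union> Y"
    using complete_bipartite_path[of X Y R x d] assms R by auto
  obtain ys where ys: "length ys = 2 * d'" "rpath R ys" "hd ys = x'" "set ys \<subseteq> X' \<union> Y'"
    using complete_bipartite_path[of X' Y' R x' d'] assms R by auto
  have "rpath R (rev xs @ ys)"
    using xs ys assms by (intro rpath_join) auto
  then show ?thesis
    by (rule rpath_take_exact) (use xs ys assms in simp)
qed

text \<open>Call \<open>Q\<close> red and its complement blue. In the depth-first search configuration with \<open>card S = card T\<close>, the
  blue graph contains the complete graphs between \<open>S \<inter> A\<close> and \<open>T \<inter> B\<close> and between \<open>S \<inter> B\<close> and
  \<open>T \<inter> A\<close>. Either a blue edge or the first vertex of \<open>U\<close> connects them, or the red path \<open>U\<close> can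
  be prolonged by a red complete bipartite graph.\<close>

lemma two_colour_path:
  assumes fin: "finite A" "finite B" and disj: "A \<inter> B = {}"
    and card: "card A = 2 * m - 1" "card B = 2 * m - 1" and m: "m \<ge> 1" and sym: "symp Q"
  shows "\<exists>xs. length xs = 2 * m \<and>
    (rpath (\<lambda>u v. link A B u v \<and> Q u v) xs \<or> rpath (\<lambda>u v. link A B u v \<and> \<not> Q u v) xs)"
proof -
  define R where "R u v \<longleftrightarrow> link A B u v \<and> Q u v" for u v
  define W where "W u v \<longleftrightarrow> link A B u v \<and> \<not> Q u v" for u v
  have symR: "symp R" and symW: "symp W"
    using sym link_sym unfolding symp_def R_def W_def by metis+
  have RW: "R u v \<or> W u v" if "link A B u v" for u v
    using that by (auto simp: R_def W_def)
  have cardV: "card (A \<union> B) = 2 * (2 * m - 1)"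
    using fin disj card by (simp add: card_Un_disjoint)
  \<comment> \<open>The difference \<open>card T - card S\<close> starts at the number of vertices,
    so after that many steps it is 0.\<close>
  obtain S T U where st: "S \<union> T \<union> set U = A \<union> B" "S \<inter> T = {}" "(S \<union> T) \<inter> set U = {}" "rpath R U"
    "\<forall>x\<in>S. \<forall>y\<in>T. \<not> R x y" "card T + card (A \<union> B) = card S + card (A \<union> B)"
    using dfs_state[of "A \<union> B" R "card (A \<union> B)"] fin symR by auto
  have finST: "finite S" "finite T"
    using st(1) fin by (metis finite_Un)+
  have "card (S \<union> T \<union> set U) = card S + card T + card (set U)"
    using finST st(2,3) by (simp add: card_Un_disjoint)
  then have "card (S \<union> T \<union> set U) = card S + card T + length U"
    using st(4) by (simp add: rpath_def distinct_card)
  with st(1,6) cardV have lenU: "length U + 2 * card S = 2 * (2 * m - 1)" by simp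
  define k where "k = 2 * m - 1 - card S"
  have k: "length U = 2 * k" using lenU by (simp add: k_def)
  have linkU: "rpath (link A B) U"
    using st(4) by (rule rpath_mono) (simp add: R_def)
  have bal: "card (set U \<inter> A) = k" "card (set U \<inter> B) = k"
    using link_path_balanced[OF linkU disj k] by auto
  let ?SA = "S \<inter> A" and ?SB = "S \<inter> B" and ?TA = "T \<inter> A" and ?TB = "T \<inter> B"
  have finq: "finite ?SA" "finite ?SB" "finite ?TA" "finite ?TB" using finST by auto
  have "A = ?SA \<union> ?TA \<union> (set U \<inter> A)" "B = ?SB \<union> ?TB \<union> (set U \<inter> B)" using st(1) by auto
  moreover have "card (?SA \<union> ?TA \<union> (set U \<inter> A)) = card ?SA + card ?TA + k"
    "card (?SB \<union> ?TB \<union> (set U \<inter> B)) = card ?SB + card ?TB + k"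
    using finST st(2,3) bal by (subst card_Un_disjoint; auto simp: card_Un_disjoint disjoint_iff)+
  ultimately have cA: "card ?SA + card ?TA + k = 2 * m - 1" and cB: "card ?SB + card ?TB + k = 2 * m - 1"
    using card by auto
  have "S = ?SA \<union> ?SB" using st(1) by auto
  then have cS: "card S = card ?SA + card ?SB"
    using card_Un_disjoint[of ?SA ?SB] finq disj by (metis Int_assoc Int_commute Int_empty_right inf_left_commute)
  define s t where "s = card ?SA" and "t = card ?SB"
  have stk: "s + t + k = 2 * m - 1" using cS lenU k by (simp add: s_def t_def k_def)
  \<comment> \<open>Both classes have \<open>2 * m - 1\<close> vertices, so the two blue complete
    bipartite graphs are balanced, with sides of size \<open>s\<close> and \<open>t\<close>
    respectively.\<close>
  have cTA: "card ?TA = t" and cTB: "card ?TB = s" using cA cB stk by (auto simp: s_def t_def)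
  have WST: "W x y" if "x \<in> ?SA \<and> y \<in> ?TB \<or> x \<in> ?TB \<and> y \<in> ?SA \<or> x \<in> ?SB \<and> y \<in> ?TA \<or> x \<in> ?TA \<and> y \<in> ?SB" for x y
  proof -
    have "link A B x y" "\<not> R x y" using that st(5) symR by (auto simp: link_def symp_def)
    then show ?thesis using RW by blast
  qed
  have goal: ?thesis if "(\<exists>xs. length xs = 2 * m \<and> rpath R xs) \<or> (\<exists>xs. length xs = 2 * m \<and> rpath W xs)"
    using that unfolding R_def W_def by blast
  show ?thesis
  proof (cases "s \<ge> m \<or> t \<ge> m \<or> k \<ge> m")
    case True
    then consider "s \<ge> m" | "t \<ge> m" | "k \<ge> m" by blast
    then show ?thesis
    proof cases
      case 1
      then obtain x where "x \<in> ?SA" using m s_def by (metis all_not_in_conv card.empty not_one_le_zero order_trans)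
      then have "\<exists>xs. length xs = 2 * m \<and> rpath W xs \<and> hd xs = x \<and> set xs \<subseteq> ?SA \<union> ?TB"
        using 1 m cTB WST disj finq by (intro complete_bipartite_path) (auto simp: s_def)
      then show ?thesis using goal by blast
    next
      case 2
      then obtain x where "x \<in> ?SB" using m t_def by (metis all_not_in_conv card.empty not_one_le_zero order_trans)
      then have "\<exists>xs. length xs = 2 * m \<and> rpath W xs \<and> hd xs = x \<and> set xs \<subseteq> ?SB \<union> ?TA"
        using 2 m cTA WST disj finq by (intro complete_bipartite_path) (auto simp: t_def)
      then show ?thesis using goal by blast
    next
      case 3
      then show ?thesis using goal rpath_take_exact[OF st(4), of "2 * m"] k by simp
    qed
  next
    case False
    \<comment> \<open>Three numbers below \<open>m\<close> with sum \<open>2 * m - 1\<close>: any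
      two sum to at least \<open>m\<close>, so each is positive.\<close>
    then have bounds: "m \<le> s + t" "1 \<le> s" "1 \<le> t" "1 \<le> k" "m \<le> t + k" "m \<le> s + k"
      using stk m by auto
    \<comment> \<open>Such an edge joins the two blue complete graphs, which gives
      \<open>2 * (s + t)\<close> vertices.\<close>
    have blue: ?thesis if "x \<in> ?SA \<and> y \<in> ?SB \<or> x \<in> ?TB \<and> y \<in> ?TA" "W x y" for x y
    proof -
      have "\<exists>xs. length xs = 2 * m \<and> rpath W xs"
      proof (cases "x \<in> ?SA \<and> y \<in> ?SB")
        case True
        then show ?thesis using that(2) symW finq st(2) disj WST bounds cTA cTB
          by (intro joined_complete_bipartite_path[of W ?SA ?TB ?SB ?TA x y s t])
            (auto simp: s_def t_def)
      next
        case False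
        then show ?thesis using that symW finq st(2) disj WST bounds cTA cTB
          by (intro joined_complete_bipartite_path[of W ?TB ?SA ?TA ?SB x y s t])
            (auto simp: s_def t_def)
      qed
      then show ?thesis using goal by blast
    qed
    show ?thesis
    proof (cases "\<exists>x y. (x \<in> ?SA \<and> y \<in> ?SB \<or> x \<in> ?TB \<and> y \<in> ?TA) \<and> W x y")
      case True
      then show ?thesis using blue by blast
    next
      case False
      then have RST: "R x y \<and> R y x" if "x \<in> ?SA \<and> y \<in> ?SB \<or> x \<in> ?TB \<and> y \<in> ?TA" for x y
        using that RW symR unfolding link_def symp_def by blast
      have U: "U \<noteq> []" using k bounds by auto
      obtain U' where U': "rpath R U'" "set U' = set U" "length U' = 2 * k" "hd U' \<in> A" "U' \<noteq> []"
      proof (cases "hd U \<in> A")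
        case True
        then show ?thesis using that st(4) k U by blast
      next
        case False
        then have "hd U \<in> B" using hd_in_set[OF U] st(1) by blast
        then have "last U \<in> A"
          using link_path_last[of B A U k] linkU link_swap[of A B] disj k bounds
          by (auto simp: rpath_def)
        then show ?thesis
          using that[of "rev U"] rpath_rev[OF st(4) symR] k U by (auto simp: hd_rev)
      qed
      define u where "u = hd U'"
      have u: "u \<in> A" "u \<notin> S" "u \<notin> T"
        using U' st(3) hd_in_set[OF U'(5)] by (auto simp: u_def)
      \<comment> \<open>Both red complete graphs, on \<open>?SA\<close>, \<open>?SB\<close> and on
        \<open>?TB\<close>, \<open>?TA\<close>, have sides of sizes \<open>s\<close> and
        \<open>t\<close>, so either yields a red path on \<open>2 * d\<close> vertices to put before
        \<open>U'\<close>.\<close>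
      define d where "d = min s t"
      have d: "1 \<le> d" "m \<le> d + k" "d \<le> s" "d \<le> t" using bounds by (auto simp: d_def)
      have red: ?thesis if "rpath R ys" "length ys = 2 * d" "set ys \<subseteq> S \<union> T" "R (hd ys) u" for ys
      proof -
        have "rpath R (rev ys @ U')"
          using that U' symR st(3) by (intro rpath_join) (auto simp: u_def)
        then show ?thesis
          using goal rpath_take_exact[of R "rev ys @ U'" "2 * m"] that(2) U'(3) d by simp
      qed
      consider y where "y \<in> ?SB" "R y u" | y where "y \<in> ?TB" "R y u"
        | "\<forall>y \<in> ?SB \<union> ?TB. W u y"
        using RW u symR unfolding link_def symp_def by blast
      then show ?thesis
      proof cases
        case (1 y)
        obtain ys where "length ys = 2 * d" "rpath R ys" "hd ys = y" "set ys \<subseteq> ?SB \<union> ?SA"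
          using complete_bipartite_path[of ?SB ?SA R y d] 1 RST finq disj d
          by (auto simp: s_def t_def)
        then show ?thesis using red 1 by blast
      next
        case (2 y)
        obtain ys where "length ys = 2 * d" "rpath R ys" "hd ys = y" "set ys \<subseteq> ?TB \<union> ?TA"
          using complete_bipartite_path[of ?TB ?TA R y d] 2 RST finq disj d cTA cTB by auto
        then show ?thesis using red 2 by blast
      next
        \<comment> \<open>Now \<open>u\<close> serves as a middle vertex between the two blue
          complete graphs.\<close>
        case 3
        obtain y y' where y: "y \<in> ?TB" "y' \<in> ?SB"
          using bounds cTB t_def by (metis card.empty ex_in_conv not_one_le_zero)
        obtain xs where xs: "length xs = 2 * s" "rpath W xs" "hd xs = y" "set xs \<subseteq> ?TB \<union> ?SA"
          using complete_bipartite_path[of ?TB ?SA W y s] y WST finq disj bounds cTB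
          by (auto simp: s_def)
        obtain ys where ys: "length ys = 2 * t" "rpath W ys" "hd ys = y'" "set ys \<subseteq> ?SB \<union> ?TA"
          using complete_bipartite_path[of ?SB ?TA W y' t] y WST finq disj bounds cTA
          by (auto simp: t_def)
        have "ys \<noteq> []" using ys(1) bounds by auto
        then have uys: "rpath W (u # ys)"
          using ys u y 3 by (auto simp: rpath_def successively_Cons)
        have "rpath W (rev xs @ (u # ys))"
        proof (rule rpath_join[OF xs(2) uys symW])
          show "set xs \<inter> set (u # ys) = {}" using xs(4) ys(4) u st(2) disj by auto
          show "W (hd xs) (hd (u # ys))" using 3 y xs(3) symW by (auto simp: symp_def)
        qed
        then show ?thesis
          using goal rpath_take_exact[of W "rev xs @ (u # ys)" "2 * m"] xs(1) ys(1) bounds by simp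
      qed
    qed
  qed
qed

section \<open>Three colours\<close>

datatype tricolour = Red | Green | Blue

text \<open>In \<open>tricoloured A B c p\<close> every vertex \<open>v\<close> sees at most two of the three colours, and \<open>p v\<close>
  is a colour missing at \<open>v\<close>. Hence edges between vertices with different missing colours have
  the third colour.\<close>

definition tricoloured :: "'a set \<Rightarrow> 'a set \<Rightarrow> ('a set \<Rightarrow> tricolour) \<Rightarrow> ('a \<Rightarrow> tricolour) \<Rightarrow> bool" where
  "tricoloured A B c p \<longleftrightarrow> (\<forall>u v. link A B u v \<longrightarrow> c {u, v} \<noteq> p u)"

definition coloured_link :: "'a set \<Rightarrow> 'a set \<Rightarrow> ('a set \<Rightarrow> 'c) \<Rightarrow> 'c \<Rightarrow> 'a \<Rightarrow> 'a \<Rightarrow> bool" where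
  "coloured_link A B c k u v \<longleftrightarrow> link A B u v \<and> c {u, v} = k"

definition mono_path :: "'a set \<Rightarrow> 'a set \<Rightarrow> ('a set \<Rightarrow> 'c) \<Rightarrow> nat \<Rightarrow> bool" where
  "mono_path A B c n \<longleftrightarrow> (\<exists>k xs. length xs = n \<and> rpath (coloured_link A B c k) xs)"

text \<open>Used with the missing colour \<open>p v\<close> as the type of \<open>v\<close>: blocks
  of different types in opposite classes are joined completely in the third colour, and only blocks
  of equal type may carry two colours.\<close>

definition block :: "'a set \<Rightarrow> ('a \<Rightarrow> 'b) \<Rightarrow> 'b \<Rightarrow> 'a set" where
  "block A p i = {a \<in> A. p a = i}"

lemma coloured_link_swap: "coloured_link A B c = coloured_link B A c"
  by (auto simp: coloured_link_def link_swap fun_eq_iff)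

lemma symp_coloured_link: "symp (coloured_link A B c k)"
  by (auto simp: symp_def coloured_link_def link_sym insert_commute)

lemma mono_path_swap: "mono_path A B = mono_path B A"
  by (auto simp: mono_path_def coloured_link_swap[of A B] fun_eq_iff)

lemma tricoloured_swap: "tricoloured A B = tricoloured B A"
  by (auto simp: tricoloured_def link_swap[of A B] fun_eq_iff)

lemma tricolour_cases:
  assumes "distinct [i, j, k]"
  obtains "x = i" | "x = j" | "x = (k :: tricolour)"
  using assms by (cases x; cases i; cases j; cases k) auto

lemma tricolouredD:
  assumes "tricoloured A B c p" "link A B u v"
  shows "c {u, v} \<noteq> p u" "c {u, v} \<noteq> p v"
proof -
  have "c {u, v} \<noteq> p u" "c {v, u} \<noteq> p v"
    using assms link_sym[OF assms(2)] unfolding tricoloured_def by blast+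
  then show "c {u, v} \<noteq> p u" "c {u, v} \<noteq> p v" by (simp_all add: insert_commute)
qed

lemma third_colour:
  assumes "tricoloured A B c p" "link A B u v" "p u \<noteq> p v" "k \<noteq> p u" "k \<noteq> p v"
  shows "c {u, v} = k"
  using assms(3-5) tricolouredD[OF assms(1,2)] tricolour_cases[of "p u" "p v" k "c {u, v}"] by auto

lemma card_blocks:
  assumes "finite A" "distinct [i, j, k :: tricolour]"
  shows "card A = card (block A p i) + card (block A p j) + card (block A p k)"
proof -
  have "A = block A p i \<union> block A p j \<union> block A p k"
    using tricolour_cases[OF assms(2)] by (auto simp: block_def)
  then have "card A = card (block A p i \<union> block A p j \<union> block A p k)" by simp
  also have "\<dots> = card (block A p i) + card (block A p j) + card (block A p k)"
    using assms by (subst card_Un_disjoint; auto simp: block_def card_Un_disjoint disjoint_iff)+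
  finally show ?thesis .
qed

lemma finite_block: "finite A \<Longrightarrow> finite (block A p i)"
  by (simp add: block_def)

lemma card_not_block:
  assumes "finite A"
  shows "card A = card (block A p i) + card {a \<in> A. p a \<noteq> i}"
proof -
  have "A = block A p i \<union> {a \<in> A. p a \<noteq> i}" by (auto simp: block_def)
  then have "card A = card (block A p i \<union> {a \<in> A. p a \<noteq> i})" by simp
  also have "\<dots> = card (block A p i) + card {a \<in> A. p a \<noteq> i}"
    using assms by (intro card_Un_disjoint) (auto simp: block_def)
  finally show ?thesis .
qed

lemma blocks_mono_path:
  assumes "tricoloured A B c p" "finite A" "finite B" "A \<inter> B = {}" "i \<noteq> j"
    and "n \<le> card (block A p i)" "n \<le> card (block B p j)" "n \<ge> 1"
  shows "mono_path A B c (2 * n)"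
proof -
  obtain k where k: "k \<noteq> i" "k \<noteq> j" by (metis tricolour.exhaust tricolour.distinct)
  obtain x where x: "x \<in> block A p i" using assms(6,8) by fastforce
  have "\<exists>xs. length xs = 2 * n \<and> rpath (coloured_link A B c k) xs \<and> hd xs = x
      \<and> set xs \<subseteq> block A p i \<union> block B p j"
  proof (rule complete_bipartite_path)
    fix x y assume "x \<in> block A p i" "y \<in> block B p j"
    then have "coloured_link A B c k x y"
      using third_colour[OF assms(1), of x y k] assms(5) k
      by (auto simp: block_def coloured_link_def link_def)
    then show "coloured_link A B c k x y \<and> coloured_link A B c k y x"
      using symp_coloured_link by (metis sympD)
  qed (use assms x finite_block in \<open>auto simp: block_def\<close>)
  then show ?thesis by (auto simp: mono_path_def)
qed

text \<open>Take \<open>r\<close> as red and all other colours as blue. A blue path is monochromatic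
  because blue edges meeting at a vertex agree.\<close>

lemma two_colour_mono_path:
  assumes "finite A" "finite B" "A \<inter> B = {}" "card A = 2 * m - 1" "card B = 2 * m - 1" "m \<ge> 1"
    and "\<And>u v w. link A B u v \<Longrightarrow> link A B v w \<Longrightarrow> c {u, v} \<noteq> r \<Longrightarrow> c {v, w} \<noteq> r \<Longrightarrow> c {u, v} = c {v, w}"
  shows "mono_path A B c (2 * m)"
proof -
  have "symp (\<lambda>u v. c {u, v} = r)" by (auto simp: symp_def insert_commute)
  then obtain xs where xs: "length xs = 2 * m" "rpath (coloured_link A B c r) xs \<or>
      rpath (\<lambda>u v. link A B u v \<and> c {u, v} \<noteq> r) xs"
    using two_colour_path[OF assms(1-6)] unfolding coloured_link_def by blast
  from xs(2) show ?thesis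
  proof
    assume "rpath (coloured_link A B c r) xs"
    then show ?thesis using xs(1) by (auto simp: mono_path_def)
  next
    assume "rpath (\<lambda>u v. link A B u v \<and> c {u, v} \<noteq> r) xs"
    from successively_equal_colour[OF this, of c] assms(6,7) xs(1)
    obtain k where "rpath (\<lambda>u v. (link A B u v \<and> c {u, v} \<noteq> r) \<and> c {u, v} = k) xs"
      by (metis (no_types, lifting) mult_le_mono2 nat_mult_1_right)
    then have "rpath (coloured_link A B c k) xs"
      by (rule rpath_mono) (simp add: coloured_link_def)
    then show ?thesis using xs(1) by (auto simp: mono_path_def)
  qed
qed

text \<open>If the first vertex of the path is joined to its last one, the path closes to a cycle, which
  is then reopened next to \<open>z\<close>.\<close>

lemma extend_path:
  assumes tri: "tricoloured A B c p" and disj: "A \<inter> B = {}" and dist: "distinct [i, j, k]"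
    and xs: "rpath (coloured_link A B c k) xs" "length xs = 2 * l" "l \<ge> 1"
    and x: "x \<in> A" "p x = j" "x \<notin> set xs" and y: "y \<in> B" "p y = i" "y \<notin> set xs"
    and z: "z \<in> B" "p z = i" "z \<in> set xs"
  shows "mono_path A B c (2 * l + 2)"
proof -
  let ?R = "coloured_link A B c k"
  have R: "?R u v \<and> ?R v u" if "u \<in> A" "v \<in> B" "p u = i \<and> p v = j \<or> p u = j \<and> p v = i" for u v
  proof -
    have "?R u v" using third_colour[OF tri, of u v k] that dist
      by (auto simp: coloured_link_def link_def)
    then show ?thesis using symp_coloured_link by (metis sympD)
  qed
  obtain ys where ys: "rpath ?R ys" "length ys = 2 * l" "set ys = set xs" "hd ys \<in> A"
  proof (cases "hd xs \<in> A")
    case True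
    then show ?thesis using that xs by blast
  next
    case False
    have ne: "xs \<noteq> []" using xs by auto
    have suc: "successively (link A B) xs"
      using xs(1) by (auto simp: rpath_def coloured_link_def intro: successively_cong_on)
    then have "hd xs \<in> B"
      using successively_link_subset[OF suc] xs(2,3) False hd_in_set[OF ne] by auto
    then have "last xs \<in> A"
      using link_path_last[of B A xs l] suc link_swap[of A B] disj xs by auto
    then show ?thesis
      using that[of "rev xs"] rpath_rev[OF xs(1) symp_coloured_link] xs(2) ne by (auto simp: hd_rev)
  qed
  have ne: "ys \<noteq> []" using ys xs by auto
  have suc: "successively (link A B) ys"
    using ys(1) by (auto simp: rpath_def coloured_link_def intro: successively_cong_on)
  have last: "last ys \<in> B"
    using link_path_last[OF suc disj ys(2) xs(3) ys(4)] .
  \<comment> \<open>A vertex on an edge of colour \<open>k\<close> has type \<open>i\<close> or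
    \<open>j\<close>; this decides how an end of the path can be joined to \<open>x\<close> or
    \<open>y\<close>.\<close>
  have pk: "p u \<noteq> k" if "?R u v" for u v
    using that tricolouredD(1)[OF tri, of u v] by (auto simp: coloured_link_def)
  obtain a b ys' where ysc: "ys = a # b # ys'"
    using ys(2) xs(3) by (cases ys; cases "tl ys") auto
  have hdk: "p (hd ys) \<noteq> k"
    using pk[of a b] ys(1) by (auto simp: ysc rpath_def)
  have "rpath ?R (rev ys)" using rpath_rev[OF ys(1) symp_coloured_link] .
  moreover obtain a b ys' where ysr: "rev ys = a # b # ys'"
    using ys(2) xs(3) by (cases "rev ys"; cases "tl (rev ys)") auto
  ultimately have "p (hd (rev ys)) \<noteq> k"
    using pk[of a b] by (auto simp: rpath_def)
  then have lastk: "p (last ys) \<noteq> k" by (simp add: hd_rev)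
  have append: ?thesis
    if zs: "rpath ?R zs" "length zs = 2 * l" "set zs = set xs" "last zs \<in> B" "p (last zs) = i" for zs
  proof -
    have "rpath ?R (zs @ [x, y])"
    proof (rule rpath_append)
      show "rpath ?R [x, y]" using x y disj R[of x y] by (auto simp: rpath_def)
      show "?R (last zs) (hd [x, y])" using x zs R[of x "last zs"] by simp
    qed (use zs x y in auto)
    then show ?thesis using zs(2) unfolding mono_path_def
      by (intro exI[of _ k] exI[of _ "zs @ [x, y]"]) simp
  qed
  show ?thesis
  proof (cases "p (last ys) = i")
    case True
    then show ?thesis using append ys last by blast
  next
    case False
    then have lj: "p (last ys) = j" using lastk tricolour_cases[OF dist] by metis
    show ?thesis
    proof (cases "p (hd ys) = i")
      case False
      then have "p (hd ys) = j" using hdk tricolour_cases[OF dist] by metis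
      \<comment> \<open>The head lies in \<open>A\<close> and has type \<open>j\<close>, so its edge
        to \<open>y\<close> has colour \<open>k\<close> and the new pair goes in front.\<close>
      have "rpath ?R ([x, y] @ ys)"
      proof (rule rpath_append)
        show "rpath ?R [x, y]" using x y disj R[of x y] by (auto simp: rpath_def)
        show "?R (last [x, y]) (hd ys)" using y R[of "hd ys" y] ys(4) \<open>p (hd ys) = j\<close> by simp
      qed (use ys x y in auto)
      then show ?thesis using ys(2) unfolding mono_path_def
        by (intro exI[of _ k] exI[of _ "[x, y] @ ys"]) simp
    next
      case True
      obtain us vs where yz: "ys = us @ z # vs"
        using z(3) ys(3) by (metis split_list)
      have "vs \<noteq> []" using lj z(2) dist by (auto simp: yz)
      have "rpath ?R (vs @ us @ [z])"
      proof (rule rpath_append)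
        show "rpath ?R vs" "rpath ?R (us @ [z])"
          using ys(1) \<open>vs \<noteq> []\<close> by (auto simp: yz rpath_def successively_append_iff successively_Cons)
        have "?R (last ys) (hd ys)" using R[of "hd ys" "last ys"] ys(4) last True lj by blast
        then show "?R (last vs) (hd (us @ [z]))"
          using \<open>vs \<noteq> []\<close> by (cases us) (auto simp: yz)
      qed (use ys(1) in \<open>auto simp: yz rpath_def\<close>)
      then show ?thesis
        using append[of "vs @ us @ [z]"] ys(2,3) z by (auto simp: yz)
    qed
  qed
qed

section \<open>Induction step with a block of at least \<open>m + 1\<close> vertices\<close>

text \<open>The path has exactly \<open>m\<close> vertices in \<open>B'\<close>. Fewer than
  \<open>m\<close> vertices of \<open>B'\<close> lie outside block \<open>i\<close>, so some
  \<open>z\<close> on the path has type \<open>i\<close>; the block has more than \<open>m\<close>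
  vertices, so some \<open>y\<close> off the path has type \<open>i\<close> too. Then
  \<open>extend_path\<close> applies to any \<open>x\<close> of the third type.\<close>

lemma extend_path_large_block:
  assumes tri: "tricoloured A B c p" and disj: "A \<inter> B = {}" and fin: "finite A" "finite B"
    and sub: "A' \<subseteq> A" "B' \<subseteq> B"
    and xs: "rpath (coloured_link A' B' c k) xs" "length xs = 2 * m" "m \<ge> 1"
    and large: "card (block B p i) \<ge> m + 1" and few: "card {b \<in> B'. p b \<noteq> i} < m"
  shows "k \<noteq> i" and "\<And>x. x \<in> A - A' \<Longrightarrow> p x \<noteq> i \<Longrightarrow> p x \<noteq> k \<Longrightarrow> mono_path A B c (2 * m + 2)"
proof -
  have disj': "A' \<inter> B' = {}" using sub disj by auto
  have "rpath (link A' B') xs"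
    using xs(1) by (rule rpath_mono) (simp add: coloured_link_def)
  then have bal: "card (set xs \<inter> B') = m" and sub': "set xs \<subseteq> A' \<union> B'"
    using link_path_balanced[of A' B' xs m] disj' xs successively_link_subset[of A' B' xs]
    by (auto simp: rpath_def)
  have "\<not> set xs \<inter> B' \<subseteq> {b \<in> B'. p b \<noteq> i}"
    using few bal card_mono[of "{b \<in> B'. p b \<noteq> i}" "set xs \<inter> B'"] fin sub
    by (auto simp: finite_subset)
  then obtain z where z: "z \<in> set xs" "z \<in> B'" "p z = i" by blast
  have xsAB: "rpath (coloured_link A B c k) xs"
    using xs(1) by (rule rpath_mono) (use sub in \<open>auto simp: coloured_link_def link_def\<close>)
  obtain n where n: "n < length xs" "z = xs ! n" using z(1) by (metis in_set_conv_nth)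
  have "\<exists>w. coloured_link A B c k z w"
  proof (cases n)
    case 0
    then have "coloured_link A B c k z (xs ! Suc 0)"
      using xsAB n xs(2,3) by (auto simp: rpath_def successively_conv_nth)
    then show ?thesis by blast
  next
    case (Suc n')
    then have "coloured_link A B c k (xs ! n') z"
      using xsAB n by (auto simp: rpath_def successively_conv_nth)
    then show ?thesis using symp_coloured_link by (metis sympD)
  qed
  then show ki: "k \<noteq> i" using tricolouredD(1)[OF tri] z(3) by (auto simp: coloured_link_def)
  fix x assume x: "x \<in> A - A'" "p x \<noteq> i" "p x \<noteq> k"
  have "\<not> block B p i \<subseteq> set xs \<inter> B'"
    using large bal card_mono[of "set xs \<inter> B'" "block B p i"] by auto
  then obtain y where y: "y \<in> B" "p y = i" "y \<notin> set xs"
    using sub' sub disj by (fastforce simp: block_def)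
  have "x \<notin> set xs" using x sub' sub disj by auto
  then show "mono_path A B c (2 * m + 2)"
    using extend_path[OF tri disj _ xsAB xs(2,3), of i "p x" x y z] x y z sub ki by auto
qed

text \<open>Both \<open>x\<close> and \<open>x'\<close> are held back from the induction. Their
  types differ, so whatever the colour \<open>k\<close> of the resulting path, one of them has a
  type other than \<open>k\<close> and prolongs it. If all of \<open>B\<close> has type
  \<open>i\<close>, colour \<open>i\<close> does not occur and two colours remain.\<close>

lemma large_block_two_types:
  assumes IH: "\<And>A' B'. A' \<subseteq> A \<Longrightarrow> B' \<subseteq> B \<Longrightarrow> card A' = 2 * m - 1 \<Longrightarrow> card B' = 2 * m - 1 \<Longrightarrow> mono_path A' B' c (2 * m)"
    and tri: "tricoloured A B c p" and disj: "A \<inter> B = {}" and fin: "finite A" "finite B"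
    and card: "card A = 2 * m + 1" "card B = 2 * m + 1" and m: "m \<ge> 1"
    and large: "card (block B p i) \<ge> m + 1"
    and x: "x \<in> A" "x' \<in> A" "p x \<noteq> p x'" "p x \<noteq> i" "p x' \<noteq> i"
  shows "mono_path A B c (2 * m + 2)"
proof (cases "\<exists>b\<in>B. p b \<noteq> i")
  case True
  then obtain b where b: "b \<in> B" "p b \<noteq> i" by blast
  obtain b' where b': "b' \<in> B" "b' \<noteq> b"
  proof -
    have "card (B - {b}) \<noteq> 0" using b fin card m by simp
    then show ?thesis using that by (metis Diff_iff card.empty ex_in_conv insertI1)
  qed
  let ?A = "A - {x, x'}" and ?B = "B - {b, b'}"
  have "x \<noteq> x'" using x by auto
  then have "card ?A = 2 * m - 1" "card ?B = 2 * m - 1"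
    using x b b' card by (simp_all add: card_Diff_subset)
  then obtain k xs where xs: "length xs = 2 * m" "rpath (coloured_link ?A ?B c k) xs"
    using IH[of ?A ?B] by (auto simp: mono_path_def)
  \<comment> \<open>At most \<open>m\<close> vertices of \<open>B\<close> lie outside block
    \<open>i\<close>, and removing \<open>b\<close> leaves fewer than \<open>m\<close>.\<close>
  have "{v \<in> ?B. p v \<noteq> i} \<subset> {v \<in> B. p v \<noteq> i}" using b by auto
  then have "card {v \<in> ?B. p v \<noteq> i} < card {v \<in> B. p v \<noteq> i}"
    using fin by (intro psubset_card_mono) auto
  then have few: "card {v \<in> ?B. p v \<noteq> i} < m"
    using card_not_block[OF fin(2), of p i] card large by linarith
  have sub: "?A \<subseteq> A" "?B \<subseteq> B" by auto
  note ext = extend_path_large_block[OF tri disj fin sub xs(2,1) m large few]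
  show ?thesis using ext(2)[of x] ext(2)[of x'] x by (cases "p x = k") auto
next
  case False
  obtain r where r: "r \<noteq> i" by (metis tricolour.distinct(1))
  have "mono_path A B c (2 * (m + 1))"
  proof (rule two_colour_mono_path[where r = r])
    fix u v w assume uv: "link A B u v" "link A B v w" "c {u, v} \<noteq> r" "c {v, w} \<noteq> r"
    have "c {u, v} \<noteq> i" if "link A B u v" for u v
      using tricolouredD[OF tri that] that False by (auto simp: link_def)
    with uv r show "c {u, v} = c {v, w}"
      by (metis (full_types) tricolour.exhaust)
  qed (use fin disj card in auto)
  then show ?thesis by simp
qed

text \<open>Unless two types other than \<open>i\<close> occur in \<open>A\<close>, its types are
  \<open>i\<close> and \<open>j\<close> only. What is left is: two large blocks of different types,
  a colour that is nobody's type, the two-type situation with the classes exchanged, or vertices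
  \<open>a\<close> of type \<open>j\<close> and \<open>b\<close> of type \<open>k\<close> to hold
  back from the induction.\<close>

lemma large_block_mono_path:
  assumes IH: "\<And>A' B'. A' \<subseteq> A \<Longrightarrow> B' \<subseteq> B \<Longrightarrow> card A' = 2 * m - 1 \<Longrightarrow> card B' = 2 * m - 1 \<Longrightarrow> mono_path A' B' c (2 * m)"
    and tri: "tricoloured A B c p" and disj: "A \<inter> B = {}" and fin: "finite A" "finite B"
    and card: "card A = 2 * m + 1" "card B = 2 * m + 1" and m: "m \<ge> 1"
    and large: "card (block B p i) \<ge> m + 1"
  shows "mono_path A B c (2 * m + 2)"
proof (cases "\<exists>x\<in>A. \<exists>x'\<in>A. p x \<noteq> p x' \<and> p x \<noteq> i \<and> p x' \<noteq> i")
  case True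
  then show ?thesis using large_block_two_types[OF assms] by blast
next
  case False
  obtain j where j: "j \<noteq> i" "\<And>x. x \<in> A \<Longrightarrow> p x = i \<or> p x = j"
  proof (cases "\<exists>x\<in>A. p x \<noteq> i")
    case True
    then show ?thesis using that False by metis
  next
    case False
    then show ?thesis using that by (metis tricolour.distinct(1))
  qed
  obtain k where k: "k \<noteq> i" "k \<noteq> j" by (metis tricolour.exhaust tricolour.distinct)
  have dist: "distinct [i, j, k]" using j k by auto
  \<comment> \<open>Both edges avoid \<open>r\<close> and the type of \<open>v\<close>, two
    different colours, so they share the remaining one.\<close>
  have missing: "c {u, v} = c {v, w}"
    if "link A B u v" "link A B v w" "c {u, v} \<noteq> r" "c {v, w} \<noteq> r" "p v \<noteq> r" for u v w r
    using tricolouredD(2)[OF tri that(1)] tricolouredD(1)[OF tri that(2)] that(3-5)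
    by (metis (full_types) tricolour.exhaust)
  have missing_type: ?thesis if "\<And>v. v \<in> A \<union> B \<Longrightarrow> p v \<noteq> r" for r
  proof -
    have "mono_path A B c (2 * (m + 1))"
    proof (rule two_colour_mono_path[where r = r])
      fix u v w
      assume uv: "link A B u v" "link A B v w" "c {u, v} \<noteq> r" "c {v, w} \<noteq> r"
      moreover have "p v \<noteq> r" using that uv by (auto simp: link_def)
      ultimately show "c {u, v} = c {v, w}" using missing by blast
    qed (use fin disj card in auto)
    then show ?thesis by simp
  qed
  have large': ?thesis if "card (block A p j) \<ge> m + 1"
    using blocks_mono_path[OF tri fin disj j(1) that large] by simp
  have Ak: "block A p k = {}" using j k by (auto simp: block_def)
  show ?thesis
  proof (cases "card (block A p j) \<ge> m + 1 \<or> (\<forall>b\<in>B. p b \<noteq> k)")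
    case True
    then show ?thesis using large' missing_type[of k] j k by auto
  next
    case False
    then obtain b where b: "b \<in> B" "p b = k" by blast
    have Ai: "card (block A p i) \<ge> m + 1"
      using card_blocks[OF fin(1) dist, of p] card Ak False by auto
    have IH': "mono_path B' A' c (2 * m)"
      if "B' \<subseteq> B" "A' \<subseteq> A" "card B' = 2 * m - 1" "card A' = 2 * m - 1" for A' B'
      using IH[OF that(2,1,4,3)] by (simp add: mono_path_swap)
    show ?thesis
    proof (cases "\<exists>b'\<in>B. p b' = j")
      case True
      then show ?thesis
        using large_block_two_types[of B A m c p i b] IH' tri disj fin card m Ai b j k
        by (auto simp: mono_path_swap[of A B] tricoloured_swap[of A B] Int_commute)
    next
      case noj: False
      show ?thesis
      proof (cases "\<exists>a\<in>A. p a = j")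
        case False
        then show ?thesis using missing_type[of j] noj by blast
      next
        case True
        then obtain a where a: "a \<in> A" "p a = j" by blast
        obtain a' where a': "a' \<in> A" "a' \<noteq> a"
        proof -
          have "card (A - {a}) \<noteq> 0" using a fin card m by simp
          then show ?thesis using that by (metis Diff_iff card.empty ex_in_conv insertI1)
        qed
        obtain b' where b': "b' \<in> B" "b' \<noteq> b"
        proof -
          have "card (B - {b}) \<noteq> 0" using b fin card m by simp
          then show ?thesis using that by (metis Diff_iff card.empty ex_in_conv insertI1)
        qed
        let ?A = "A - {a, a'}" and ?B = "B - {b, b'}"
        have "card ?A = 2 * m - 1" "card ?B = 2 * m - 1"
          using a a' b b' card by (simp_all add: card_Diff_subset)
        then obtain l xs where xs: "length xs = 2 * m" "rpath (coloured_link ?A ?B c l) xs"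
          using IH[of ?A ?B] by (auto simp: mono_path_def)
        have "{v \<in> ?B. p v \<noteq> i} \<subset> {v \<in> B. p v \<noteq> i}" "{v \<in> ?A. p v \<noteq> i} \<subset> {v \<in> A. p v \<noteq> i}"
          using a b j k by auto
        then have "card {v \<in> ?B. p v \<noteq> i} < card {v \<in> B. p v \<noteq> i}"
          "card {v \<in> ?A. p v \<noteq> i} < card {v \<in> A. p v \<noteq> i}"
          using fin by (auto intro: psubset_card_mono)
        then have few: "card {v \<in> ?B. p v \<noteq> i} < m" "card {v \<in> ?A. p v \<noteq> i} < m"
          using card_not_block[OF fin(2), of p i] card_not_block[OF fin(1), of p i] card large Ai
          by linarith+
        have sub: "?A \<subseteq> A" "?B \<subseteq> B" by auto
        have tri': "tricoloured B A c p" and disj': "B \<inter> A = {}"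
          using tri disj by (auto simp: tricoloured_swap)
        have xs': "rpath (coloured_link ?B ?A c l) xs" using xs(2) by (simp add: coloured_link_swap)
        note ext = extend_path_large_block[OF tri disj fin sub xs(2,1) m large few(1)]
        note ext' = extend_path_large_block[OF tri' disj' fin(2,1) sub(2,1) xs' xs(1) m Ai few(2)]
        \<comment> \<open>The colour \<open>l\<close> differs from \<open>i\<close>. If it is
          \<open>j\<close>, then \<open>b\<close> prolongs the path, with the classes exchanged;
          otherwise \<open>a\<close> does.\<close>
        show ?thesis
          using ext(2)[of a] ext'(2)[of b] a b j k
          by (cases "l = j") (auto simp: mono_path_swap[of B A])
      qed
    qed
  qed
qed

section \<open>Induction step with all blocks of at most \<open>m\<close> vertices\<close>

text \<open>Colour \<open>j\<close> joins block \<open>i\<close> of \<open>A\<close> to blocks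
  \<open>i\<close> and \<open>k\<close> of \<open>B\<close>, and block \<open>k\<close> of
  \<open>A\<close> to block \<open>i\<close> of \<open>B\<close>. Reserving a part \<open>Y\<close>
  of block \<open>i\<close> of \<open>B\<close> for block \<open>k\<close> of \<open>A\<close>
  yields two disjoint complete bipartite graphs with an edge between them.\<close>

lemma one_colour_diagonal_mono_path:
  assumes tri: "tricoloured A B c p" and disj: "A \<inter> B = {}" and fin: "finite A" "finite B"
    and dist: "distinct [i, j, k]"
    and diag: "\<And>a b. a \<in> block A p i \<Longrightarrow> b \<in> block B p i \<Longrightarrow> c {a, b} = j"
    and pos: "1 \<le> card (block A p i)" "1 \<le> card (block A p k)" "1 \<le> card (block B p k)"
    and le: "card (block A p k) \<le> card (block B p i)"
    and n: "n \<le> card (block A p i) + card (block A p k)" "n \<le> card (block B p i) + card (block B p k)"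
  shows "mono_path A B c (2 * n)"
proof -
  let ?R = "coloured_link A B c j"
  have R: "?R u v" if "u \<in> A \<and> v \<in> B \<or> u \<in> B \<and> v \<in> A" "p u = i \<and> p v = k \<or> p u = k \<and> p v = i" for u v
    using third_colour[OF tri, of u v j] that dist by (auto simp: coloured_link_def link_def)
  have R': "?R u v" if "u \<in> A" "v \<in> B" "p u = i" "p v = i" for u v
    using diag[of u v] that by (auto simp: block_def coloured_link_def link_def)
  obtain Y where Y: "Y \<subseteq> block B p i" "card Y = card (block A p k)"
    using obtain_subset_with_card_n[OF le] by metis
  have finY: "finite Y" using Y(1) fin finite_block finite_subset by metis
  obtain y where y: "y \<in> Y" using pos(2) Y(2) by (metis card.empty ex_in_conv not_one_le_zero)
  obtain x where x: "x \<in> block A p i" using pos(1) by (metis card.empty ex_in_conv not_one_le_zero)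
  let ?Z = "(block B p i - Y) \<union> block B p k"
  have "card ?Z = card (block B p i - Y) + card (block B p k)"
    using fin finite_block dist by (intro card_Un_disjoint) (auto simp: block_def)
  then have Z: "card ?Z = card (block B p i) - card (block A p k) + card (block B p k)"
    using Y finY by (simp add: card_Diff_subset)
  define d where "d = min (card (block A p i)) (card ?Z)"
  have d: "1 \<le> d" "d \<le> card (block A p i)" "d \<le> card ?Z" "n \<le> card (block A p k) + d"
    using pos Z le n by (auto simp: d_def)
  have "\<exists>xs. length xs = 2 * n \<and> rpath ?R xs"
  proof (rule joined_complete_bipartite_path)
    show "?R u v" if "u \<in> Y" "v \<in> block A p k" for u v
      using that Y(1) R[of u v] by (auto simp: block_def)
    show "?R u v" if "u \<in> block A p i" "v \<in> ?Z" for u v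
      using that R[of u v] R'[of u v] by (auto simp: block_def)
    have "?R x y" using R'[of x y] x y Y(1) by (auto simp: block_def)
    then show "?R y x" by (rule sympD[OF symp_coloured_link])
    show "symp ?R" by (rule symp_coloured_link)
    show "2 * n \<le> 2 * (card Y + d)" using d Y(2) by simp
    show "(Y \<union> block A p k) \<inter> (block A p i \<union> ?Z) = {}" "Y \<inter> block A p k = {}"
      "block A p i \<inter> ?Z = {}"
      using Y(1) disj dist by (auto simp: block_def)
  qed (use finY fin finite_block x y d pos(2) Y(2) in auto)
  then show ?thesis by (auto simp: mono_path_def)
qed

text \<open>Colour \<open>j\<close> joins block \<open>i\<close> of each class completely to block
  \<open>k\<close> of the other; the edge between \<open>a\<close> and \<open>b\<close> connects
  these two complete graphs.\<close>

lemma diagonal_edge_mono_path: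
  assumes tri: "tricoloured A B c p" and disj: "A \<inter> B = {}" and fin: "finite A" "finite B"
    and dist: "distinct [i, j, k]"
    and diag: "a \<in> block A p i" "b \<in> block B p i" "c {a, b} = j"
    and d: "1 \<le> d" "d \<le> card (block A p i)" "d \<le> card (block B p k)"
    and d': "1 \<le> d'" "d' \<le> card (block B p i)" "d' \<le> card (block A p k)"
    and n: "n \<le> d + d'"
  shows "mono_path A B c (2 * n)"
proof -
  let ?R = "coloured_link A B c j"
  have R: "?R u v" if "u \<in> A \<and> v \<in> B \<or> u \<in> B \<and> v \<in> A" "p u = i \<and> p v = k" for u v
    using third_colour[OF tri, of u v j] that dist by (auto simp: coloured_link_def link_def)
  have "\<exists>xs. length xs = 2 * n \<and> rpath ?R xs"
  proof (rule joined_complete_bipartite_path)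
    show "?R u v" if "u \<in> block A p i" "v \<in> block B p k" for u v
      using that R[of u v] by (auto simp: block_def)
    show "?R u v" if "u \<in> block B p i" "v \<in> block A p k" for u v
      using that R[of u v] by (auto simp: block_def)
    show "?R a b" using diag by (auto simp: block_def coloured_link_def link_def)
    show "symp ?R" by (rule symp_coloured_link)
    show "(block A p i \<union> block B p k) \<inter> (block B p i \<union> block A p k) = {}"
      "block A p i \<inter> block B p k = {}" "block B p i \<inter> block A p k = {}"
      using disj dist by (auto simp: block_def)
    show "2 * n \<le> 2 * (d + d')" using n by simp
  qed (use fin finite_block diag d d' in auto)
  then show ?thesis by (auto simp: mono_path_def)
qed

text \<open>No block is empty, and any two blocks of a class have together at least
  \<open>m + 1\<close> vertices. Between the two blocks \<open>i\<close> only \<open>j\<close> and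
  \<open>k\<close> occur: either one colour takes all these edges, or both are available for a
  connecting edge.\<close>

lemma small_blocks_mono_path:
  assumes tri: "tricoloured A B c p" and disj: "A \<inter> B = {}" and fin: "finite A" "finite B"
    and card: "card A = 2 * m + 1" "card B = 2 * m + 1"
    and small: "\<And>l. card (block A p l) \<le> m" "\<And>l. card (block B p l) \<le> m"
    and max: "\<And>l. card (block A p l) \<le> card (block B p i)"
  shows "mono_path A B c (2 * m + 2)"
proof -
  obtain j k where dist: "distinct [i, j, k]"
    by (cases i) (auto intro: that[of Green Blue] that[of Red Blue] that[of Red Green])
  then have dist': "distinct [i, k, j]" by auto
  let ?a = "\<lambda>l. card (block A p l)" and ?b = "\<lambda>l. card (block B p l)"
  have sum: "?a i + ?a j + ?a k = 2 * m + 1" "?b i + ?b j + ?b k = 2 * m + 1"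
    using card_blocks[OF fin(1) dist, of p] card_blocks[OF fin(2) dist, of p] card by simp_all
  note sm = small(1)[of i] small(1)[of j] small(1)[of k] small(2)[of i] small(2)[of j] small(2)[of k]
  have "mono_path A B c (2 * (m + 1))"
  proof (cases "(\<forall>a\<in>block A p i. \<forall>b\<in>block B p i. c {a, b} = j)
      \<or> (\<forall>a\<in>block A p i. \<forall>b\<in>block B p i. c {a, b} = k)")
    case True
    then show ?thesis
    proof
      assume "\<forall>a\<in>block A p i. \<forall>b\<in>block B p i. c {a, b} = j"
      then show ?thesis
        using one_colour_diagonal_mono_path[OF tri disj fin dist, of "m + 1"] sum sm max by simp
    next
      assume "\<forall>a\<in>block A p i. \<forall>b\<in>block B p i. c {a, b} = k"
      then show ?thesis
        using one_colour_diagonal_mono_path[OF tri disj fin dist', of "m + 1"] sum sm max by simp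
    qed
  next
    case False
    have *: "c {a, b} = j \<or> c {a, b} = k" if "a \<in> block A p i" "b \<in> block B p i" for a b
    proof -
      have "c {a, b} \<noteq> i" using that tri by (auto simp: block_def tricoloured_def link_def)
      then show ?thesis using tricolour_cases[OF dist] by metis
    qed
    obtain a b where ab: "a \<in> block A p i" "b \<in> block B p i" "c {a, b} = j"
      using False * by blast
    obtain a' b' where ab': "a' \<in> block A p i" "b' \<in> block B p i" "c {a', b'} = k"
      using False * by blast
    \<comment> \<open>If both failed, \<open>?a k + ?b k\<close> and \<open>?a j + ?b j\<close>
      would be at most \<open>m\<close>, whereas blocks \<open>j\<close> and \<open>k\<close>
      contain at least \<open>m + 1\<close> vertices of each class.\<close>
    have "m + 1 \<le> min (?a i) (?b k) + ?a k \<or> m + 1 \<le> min (?a i) (?b j) + ?a j"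
      using sum sm by linarith
    then show ?thesis
    proof
      assume "m + 1 \<le> min (?a i) (?b k) + ?a k"
      then show ?thesis
        using diagonal_edge_mono_path[OF tri disj fin dist ab, of "min (?a i) (?b k)" "?a k" "m + 1"]
          max[of k] sum sm by simp
    next
      assume "m + 1 \<le> min (?a i) (?b j) + ?a j"
      then show ?thesis
        using diagonal_edge_mono_path[OF tri disj fin dist' ab', of "min (?a i) (?b j)" "?a j" "m + 1"]
          max[of j] sum sm by simp
    qed
  qed
  then show ?thesis by simp
qed

lemma tricoloured_mono_path:
  assumes "tricoloured A B c p" "A \<inter> B = {}" "finite A" "finite B"
    and "card A = 2 * m - 1" "card B = 2 * m - 1" "m \<ge> 1"
  shows "mono_path A B c (2 * m)"
  using assms(7,1-6)
proof (induction m arbitrary: A B rule: nat_induct_at_least)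
  case base
  then obtain a b where "A = {a}" "B = {b}" by (auto simp: card_Suc_eq numeral_2_eq_2)
  then show ?case using base.prems(2) unfolding mono_path_def
    by (intro exI[of _ "c {a, b}"] exI[of _ "[a, b]"]) (auto simp: rpath_def coloured_link_def link_def)
next
  case (Suc m)
  have card: "card A = 2 * m + 1" "card B = 2 * m + 1" using Suc.prems by auto
  have IH: "mono_path A' B' c (2 * m)"
    if "A' \<subseteq> A" "B' \<subseteq> B" "card A' = 2 * m - 1" "card B' = 2 * m - 1" for A' B'
  proof (rule Suc.IH)
    show "tricoloured A' B' c p"
      using Suc.prems(1) that unfolding tricoloured_def link_def by blast
    show "A' \<inter> B' = {}" using Suc.prems(2) that by auto
  qed (use Suc.prems that finite_subset in auto)
  have IH': "mono_path B' A' c (2 * m)"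
    if "B' \<subseteq> B" "A' \<subseteq> A" "card B' = 2 * m - 1" "card A' = 2 * m - 1" for A' B'
    using IH[OF that(2,1,4,3)] by (simp add: mono_path_swap)
  have tri': "tricoloured B A c p" and disj': "B \<inter> A = {}"
    using Suc.prems by (auto simp: tricoloured_swap)
  have "mono_path A B c (2 * m + 2)"
  proof (cases "\<exists>l. card (block A p l) \<ge> m + 1 \<or> card (block B p l) \<ge> m + 1")
    case True
    then show ?thesis
      using large_block_mono_path[OF IH Suc.prems(1-4) card Suc.hyps]
        large_block_mono_path[OF IH' tri' disj' Suc.prems(4,3) card(2,1) Suc.hyps]
      by (auto simp: mono_path_swap[of B A])
  next
    case False
    then have small: "card (block A p l) \<le> m" "card (block B p l) \<le> m" for l
      by (auto simp: not_le less_Suc_eq_le)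
    have ex_max: "\<exists>i. \<forall>l. f l \<le> f i" for f :: "tricolour \<Rightarrow> nat"
    proof -
      have "(UNIV :: tricolour set) = {Red, Green, Blue}" by (auto intro: tricolour.exhaust)
      then have "finite (range f)" by (metis finite.simps finite_imageI)
      then have "Max (range f) \<in> range f" "\<forall>l. f l \<le> Max (range f)" by auto
      then show ?thesis by (metis rangeE)
    qed
    obtain i where i: "\<And>l. card (block A p l) \<le> card (block A p i)"
      using ex_max[of "\<lambda>l. card (block A p l)"] by blast
    obtain i' where i': "\<And>l. card (block B p l) \<le> card (block B p i')"
      using ex_max[of "\<lambda>l. card (block B p l)"] by blast
    \<comment> \<open>Exchanging the classes if necessary, a largest block of all lies in the second
      class.\<close>
    show ?thesis
    proof (cases "card (block A p i) \<le> card (block B p i')")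
      case True
      then show ?thesis
        using small_blocks_mono_path[OF Suc.prems(1-4) card small] i order_trans by blast
    next
      case False
      then have "card (block B p l) \<le> card (block A p i)" for l
        using i'[of l] by linarith
      then show ?thesis
        using small_blocks_mono_path[OF tri' disj' Suc.prems(4,3) card(2,1) small(2,1), of i]
        by (simp add: mono_path_swap[of B A])
    qed
  qed
  then show ?case by simp
qed

section \<open>Identifying colours\<close>

text \<open>A vertex still sees at most two of the three merged colours, so the three-colour result
  applies. Injectivity at each vertex undoes the merging: consecutive edges agreeing under
  \<open>\<phi>\<close> had the same colour before.\<close>

lemma merge_colours_mono_path:
  fixes c :: "'a set \<Rightarrow> 'c" and \<phi> :: "'c \<Rightarrow> tricolour"
  assumes "A \<inter> B = {}" "finite A" "finite B" "card A = 2 * m - 1" "card B = 2 * m - 1" "m \<ge> 1"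
    and K: "\<And>v. v \<in> A \<union> B \<Longrightarrow> finite (K v) \<and> card (K v) \<le> 2"
    and cK: "\<And>u v. link A B u v \<Longrightarrow> c {u, v} \<in> K u"
    and inj: "\<And>v. v \<in> A \<union> B \<Longrightarrow> inj_on \<phi> (K v)"
  shows "mono_path A B c (2 * m)"
proof -
  have "\<exists>t. t \<notin> \<phi> ` K v" if "v \<in> A \<union> B" for v
  proof (rule ccontr)
    assume "\<nexists>t. t \<notin> \<phi> ` K v"
    then have "{Red, Green, Blue} \<subseteq> \<phi> ` K v" by blast
    then have "card {Red, Green, Blue} \<le> card (\<phi> ` K v)" using K[OF that] by (intro card_mono) auto
    also have "\<dots> \<le> 2" using K[OF that] card_image_le order_trans by blast
    finally show False by simp
  qed
  then obtain p where p: "\<And>v. v \<in> A \<union> B \<Longrightarrow> p v \<notin> \<phi> ` K v" by metis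
  have cK': "c {u, v} \<in> K v" if "link A B u v" for u v
    using cK[OF link_sym[OF that]] by (simp add: insert_commute)
  have "tricoloured A B (\<phi> \<circ> c) p"
    unfolding tricoloured_def
  proof (intro allI impI)
    fix u v assume uv: "link A B u v"
    then have "u \<in> A \<union> B" by (auto simp: link_def)
    from p[OF this] cK[OF uv] show "(\<phi> \<circ> c) {u, v} \<noteq> p u" by force
  qed
  then have "mono_path A B (\<phi> \<circ> c) (2 * m)"
    using assms by (intro tricoloured_mono_path)
  then obtain k xs where xs: "length xs = 2 * m" "rpath (coloured_link A B (\<phi> \<circ> c) k) xs"
    by (auto simp: mono_path_def)
  have "c {u, v} = c {v, w}"
    if "coloured_link A B (\<phi> \<circ> c) k u v" "coloured_link A B (\<phi> \<circ> c) k v w" for u v w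
  proof (rule inj_onD)
    have uv: "link A B u v" "link A B v w" using that by (auto simp: coloured_link_def)
    then show "inj_on \<phi> (K v)" by (intro inj) (auto simp: link_def)
    show "c {u, v} \<in> K v" "c {v, w} \<in> K v" using cK cK' uv by auto
  qed (use that in \<open>auto simp: coloured_link_def\<close>)
  from successively_equal_colour[where c = c, OF xs(2) _ this] assms(6) xs(1)
  obtain r where "rpath (\<lambda>u v. coloured_link A B (\<phi> \<circ> c) k u v \<and> c {u, v} = r) xs"
    by (metis (no_types, lifting) mult_le_mono2 nat_mult_1_right)
  then have "rpath (coloured_link A B c r) xs"
    by (rule rpath_mono) (simp add: coloured_link_def)
  then show ?thesis using xs(1) by (auto simp: mono_path_def)
qed

text \<open>No vertex of \<open>A\<close> sees both \<open>x\<close> and \<open>y\<close>, so all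
  its edges to \<open>B'\<close> have the same colour. By pigeonhole one of the two colours serves
  at least \<open>m\<close> vertices of \<open>A\<close>.\<close>

lemma split_mono_path:
  assumes "A \<inter> B = {}" "finite A" "finite B" "card A = 2 * m - 1" "m \<ge> 1"
    and cK: "\<And>u v. link A B u v \<Longrightarrow> c {u, v} \<in> K u"
    and B': "B' \<subseteq> B" "m \<le> card B'" "\<And>b. b \<in> B' \<Longrightarrow> K b \<subseteq> {x, y}"
    and A: "\<And>a. a \<in> A \<Longrightarrow> \<not> {x, y} \<subseteq> K a"
  shows "mono_path A B c (2 * m)"
proof -
  have one: ?thesis if A': "A' \<subseteq> A" "m \<le> card A'" "\<And>a b. a \<in> A' \<Longrightarrow> b \<in> B' \<Longrightarrow> c {a, b} = r" for A' r
  proof -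
    obtain a where a: "a \<in> A'" using A'(2) assms(5) by fastforce
    have "\<exists>xs. length xs = 2 * m \<and> rpath (coloured_link A B c r) xs \<and> hd xs = a \<and> set xs \<subseteq> A' \<union> B'"
    proof (rule complete_bipartite_path)
      fix u v assume "u \<in> A'" "v \<in> B'"
      then have "coloured_link A B c r u v"
        using A' B'(1) by (auto simp: coloured_link_def link_def)
      then show "coloured_link A B c r u v \<and> coloured_link A B c r v u"
        using symp_coloured_link by (metis sympD)
    qed (use assms A' B' a finite_subset in auto)
    then show ?thesis by (auto simp: mono_path_def)
  qed
  have col: "c {a, b} \<in> K a \<and> c {a, b} \<in> {x, y}" if "a \<in> A" "b \<in> B'" for a b
    using cK[of a b] cK[of b a] B'(1) B'(3)[OF that(2)] that by (auto simp: link_def insert_commute)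
  let ?A1 = "{a \<in> A. x \<notin> K a}" and ?A2 = "{a \<in> A. x \<in> K a}"
  have "A = ?A1 \<union> ?A2" by auto
  then have "card A \<le> card ?A1 + card ?A2" by (metis card_Un_le)
  then consider "m \<le> card ?A1" | "m \<le> card ?A2" using assms(4,5) by linarith
  then show ?thesis
  proof cases
    case 1
    show ?thesis
      by (rule one[OF _ 1, of y]) (use col in auto)
  next
    case 2
    show ?thesis
      by (rule one[OF _ 2, of x]) (use col A in auto)
  qed
qed

lemma four_colours_mono_path:
  assumes "A \<inter> B = {}" "finite A" "finite B" "card A = 2 * m - 1" "card B = 2 * m - 1" "m \<ge> 1"
    and cK: "\<And>u v. link A B u v \<Longrightarrow> c {u, v} \<in> K u"
    and B: "\<And>b. b \<in> B \<Longrightarrow> K b \<subseteq> {w, x} \<or> K b \<subseteq> {y, z}"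
    and A: "\<And>a. a \<in> A \<Longrightarrow> \<not> {w, x} \<subseteq> K a \<and> \<not> {y, z} \<subseteq> K a"
  shows "mono_path A B c (2 * m)"
proof -
  let ?B1 = "{b \<in> B. K b \<subseteq> {w, x}}" and ?B2 = "{b \<in> B. K b \<subseteq> {y, z}}"
  have "B = ?B1 \<union> ?B2" using B by auto
  then have "card B \<le> card ?B1 + card ?B2" by (metis card_Un_le)
  then consider "m \<le> card ?B1" | "m \<le> card ?B2" using assms(5,6) by linarith
  then show ?thesis
  proof cases
    case 1
    show ?thesis by (rule split_mono_path[where K = K and c = c, OF assms(1-4,6) cK _ 1, of w x]) (use A in auto)
  next
    case 2
    show ?thesis by (rule split_mono_path[where K = K and c = c, OF assms(1-4,6) cK _ 2, of y z]) (use A in auto)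
  qed
qed

lemma card_le_2_eqI:
  assumes "finite X" "card X \<le> 2" "x \<in> X" "y \<in> X" "x \<noteq> y"
  shows "X = {x, y}"
  using card_seteq[of X "{x, y}"] assms by auto

lemma card_le_2_subset:
  assumes "finite X" "card X \<le> 2"
  obtains x y where "X \<subseteq> {x, y}"
proof -
  consider "card X = 0" | "card X = 1" | "card X = 2" using assms(2) by linarith
  then show ?thesis
  proof cases
    case 1
    then show ?thesis using that assms(1) by auto
  next
    case 2
    then show ?thesis using that by (auto simp: card_1_singleton_iff)
  next
    case 3
    then show ?thesis using that by (auto simp: card_2_iff)
  qed
qed

lemma local_colouring_mono_path:
  fixes c :: "'a set \<Rightarrow> 'c"
  assumes AB: "A \<inter> B = {}" "finite A" "finite B" "card A = 2 * m - 1" "card B = 2 * m - 1" "m \<ge> 1"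
    and K: "\<And>v. v \<in> A \<union> B \<Longrightarrow> finite (K v) \<and> card (K v) \<le> 2"
    and cK: "\<And>u v. link A B u v \<Longrightarrow> c {u, v} \<in> K u"
  shows "mono_path A B c (2 * m)"
proof (cases "\<exists>x y. \<forall>v\<in>A \<union> B. x \<in> K v \<or> y \<in> K v")
  case True
  then obtain x y where xy: "\<forall>v\<in>A \<union> B. x \<in> K v \<or> y \<in> K v" by blast
  \<comment> \<open>A vertex sees at most two colours, one of them \<open>x\<close> or
    \<open>y\<close>, hence at most one other; so all other colours can be identified.\<close>
  let ?\<phi> = "\<lambda>z. if z = x then Red else if z = y then Green else Blue"
  have "inj_on ?\<phi> (K v)" if "v \<in> A \<union> B" for v
  proof (rule inj_onI, rule ccontr)
    fix s t assume st: "s \<in> K v" "t \<in> K v" "?\<phi> s = ?\<phi> t" "s \<noteq> t"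
    then have "K v = {s, t}" using K[OF that] by (intro card_le_2_eqI) auto
    then have "x \<in> {s, t} \<or> y \<in> {s, t}" using xy that by blast
    then show False using st(3,4) by (auto split: if_splits)
  qed
  from merge_colours_mono_path[where K = K and c = c and \<phi> = ?\<phi>, OF AB K cK this] show ?thesis .
next
  case False
  have meet: "\<exists>z. z \<in> K a \<and> z \<in> K b" if "a \<in> A" "b \<in> B" for a b
    using cK[of a b] cK[of b a] that by (auto simp: link_def insert_commute)
  \<comment> \<open>The colours at \<open>u\<close> fit into a pair, and no pair meets all colour
    sets. By \<open>meet\<close> the vertex found lies in the class of \<open>u\<close>.\<close>
  have miss: "\<exists>v\<in>A \<union> B. K u \<inter> K v = {}" if u: "u \<in> A \<union> B" for u
  proof -
    obtain x y where "K u \<subseteq> {x, y}" using card_le_2_subset[of "K u"] K[OF u] by blast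
    moreover have "\<exists>v\<in>A \<union> B. x \<notin> K v \<and> y \<notin> K v" using False by blast
    ultimately show ?thesis by blast
  qed
  have "A \<noteq> {}" "B \<noteq> {}" using AB by auto
  then obtain a b where ab: "a \<in> A" "b \<in> B" by blast
  obtain a' where a': "a' \<in> A" "K a \<inter> K a' = {}" using miss[of a] meet ab by blast
  obtain b' where b': "b' \<in> B" "K b \<inter> K b' = {}" using miss[of b] meet ab by blast
  \<comment> \<open>The four common colours are distinct, as \<open>K a\<close> is disjoint from
    \<open>K a'\<close> and \<open>K b\<close> from \<open>K b'\<close>; hence they exhaust these
    four sets.\<close>
  obtain w where w: "w \<in> K a" "w \<in> K b" using meet[OF ab(1,2)] by blast
  obtain x where x: "x \<in> K a'" "x \<in> K b" using meet[OF a'(1) ab(2)] by blast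
  obtain y where y: "y \<in> K a" "y \<in> K b'" using meet[OF ab(1) b'(1)] by blast
  obtain z where z: "z \<in> K a'" "z \<in> K b'" using meet[OF a'(1) b'(1)] by blast
  have dist: "distinct [w, x, y, z]" using w x y z a' b' by auto
  have Ks: "K a = {w, y}" "K a' = {x, z}" "K b = {w, x}" "K b' = {y, z}"
    by (rule card_le_2_eqI; use K ab a' b' w x y z dist in auto)+
  have KA: "\<exists>s\<in>{w, x}. \<exists>t\<in>{y, z}. K v = {s, t}" if v: "v \<in> A" for v
  proof -
    obtain s t where "s \<in> {w, x}" "s \<in> K v" "t \<in> {y, z}" "t \<in> K v"
      using meet[OF v ab(2)] meet[OF v b'(1)] Ks by auto
    moreover from this have "K v = {s, t}" using K v dist by (intro card_le_2_eqI) auto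
    ultimately show ?thesis by blast
  qed
  have KB: "\<exists>s\<in>{w, y}. \<exists>t\<in>{x, z}. K v = {s, t}" if v: "v \<in> B" for v
  proof -
    obtain s t where "s \<in> {w, y}" "s \<in> K v" "t \<in> {x, z}" "t \<in> K v"
      using meet[OF ab(1) v] meet[OF a'(1) v] Ks by auto
    moreover from this have "K v = {s, t}" using K v dist by (intro card_le_2_eqI) auto
    ultimately show ?thesis by blast
  qed
  \<comment> \<open>Here \<open>s\<close> and \<open>t\<close> both become \<open>Blue\<close>,
    which is harmless as no vertex sees exactly these two.\<close>
  have merge: ?thesis if st: "\<And>v. v \<in> A \<union> B \<Longrightarrow> K v \<noteq> {s, t}"
    and perm: "{w, x, y, z} = {s, t, s', t'}" for s t s' t'
  proof -
    let ?\<phi> = "\<lambda>r. if r = s' then Red else if r = t' then Green else Blue"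
    have "inj_on ?\<phi> (K v)" if "v \<in> A \<union> B" for v
    proof (rule inj_onI, rule ccontr)
      fix q r assume qr: "q \<in> K v" "r \<in> K v" "?\<phi> q = ?\<phi> r" "q \<noteq> r"
      then have Kv: "K v = {q, r}" using K[OF that] by (intro card_le_2_eqI) auto
      have "K v \<subseteq> {s, t, s', t'}" unfolding perm[symmetric] using KA[of v] KB[of v] that by auto
      then have "{q, r} = {s, t}" using qr by (auto split: if_splits)
      then show False using st[OF that] Kv by simp
    qed
    from merge_colours_mono_path[where K = K and c = c and \<phi> = ?\<phi>, OF AB K cK this] show ?thesis .
  qed
  \<comment> \<open>By \<open>KA\<close> and \<open>KB\<close>, the sets \<open>{w, z}\<close> and
    \<open>{x, y}\<close> are the only ones that both classes could have. If one of them does not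
    occur, its colours are merged.\<close>
  show ?thesis
  proof (cases "(\<exists>v\<in>A \<union> B. K v = {w, z}) \<and> (\<exists>v\<in>A \<union> B. K v = {x, y})")
    case False
    then show ?thesis using merge[of w z x y] merge[of x y w z] by (auto simp: insert_commute)
  next
    case True
    then obtain v v' where v: "v \<in> A \<union> B" "K v = {w, z}" "v' \<in> A \<union> B" "K v' = {x, y}" by blast
    \<comment> \<open>Vertices with disjoint colour sets cannot be adjacent.\<close>
    have "v \<in> A \<and> v' \<in> A \<or> v \<in> B \<and> v' \<in> B"
      using v meet[of v v'] meet[of v' v] dist by auto
    then show ?thesis
    proof
      assume vA: "v \<in> A \<and> v' \<in> A"
      show ?thesis
      proof (rule four_colours_mono_path[where K = K and c = c, OF AB cK])
        \<comment> \<open>The set \<open>K u\<close> meets both \<open>{w, z}\<close> and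
          \<open>{x, y}\<close>, so it is neither of them, and \<open>KB\<close> leaves the two
          others.\<close>
        show "K u \<subseteq> {w, x} \<or> K u \<subseteq> {y, z}" if "u \<in> B" for u
          using KB[OF that] meet[of v u] meet[of v' u] v vA that dist by auto
        show "\<not> {w, x} \<subseteq> K u \<and> \<not> {y, z} \<subseteq> K u" if u: "u \<in> A" for u
        proof -
          obtain s t where "s \<in> {w, x}" "t \<in> {y, z}" "K u = {s, t}" using KA[OF u] by blast
          then show ?thesis using dist by (elim insertE emptyE; clarsimp; blast)
        qed
      qed
    next
      assume vB: "v \<in> B \<and> v' \<in> B"
      \<comment> \<open>The same argument with the classes exchanged and the colours
        \<open>x\<close> and \<open>y\<close> exchanged.\<close>
      have "mono_path B A c (2 * m)"
      proof (rule four_colours_mono_path)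
        show "K u \<subseteq> {w, y} \<or> K u \<subseteq> {x, z}" if "u \<in> A" for u
          using KA[OF that] meet[of u v] meet[of u v'] v vB that dist by auto
        show "\<not> {w, y} \<subseteq> K u \<and> \<not> {x, z} \<subseteq> K u" if u: "u \<in> B" for u
        proof -
          obtain s t where "s \<in> {w, y}" "t \<in> {x, z}" "K u = {s, t}" using KB[OF u] by blast
          then show ?thesis using dist by (elim insertE emptyE; clarsimp; blast)
        qed
        show "c {s, t} \<in> K s" if "link B A s t" for s t
          using that cK by (simp add: link_swap)
      qed (use AB in auto)
      then show ?thesis by (simp add: mono_path_swap)
    qed
  qed
qed

theorem theorem1p6:
  fixes m :: nat and V :: "'a set" and E :: "'a set set" and c :: "'a set \<Rightarrow> 'c"
  assumes "m \<ge> 1"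
    and "complete_bipartite (2 * m - 1) (2 * m - 1) V E"
    and "local_colouring 2 V E c"
  shows "\<exists>xs. length xs = 2 * m \<and> monochromatic_path V E c xs"
proof -
  obtain A B where AB: "finite A" "finite B" "card A = 2 * m - 1" "card B = 2 * m - 1" "A \<inter> B = {}"
    and V: "V = A \<union> B" and E: "E = {{a, b} |a b. a \<in> A \<and> b \<in> B}"
    using assms(2) unfolding complete_bipartite_def by blast
  have linkE: "{u, v} \<in> E" if "link A B u v" for u v
    using that unfolding link_def E by (auto simp: insert_commute)
  have "mono_path A B c (2 * m)"
  proof (rule local_colouring_mono_path[where K = "\<lambda>v. c ` {e \<in> E. v \<in> e}"])
    show "finite (c ` {e \<in> E. v \<in> e}) \<and> card (c ` {e \<in> E. v \<in> e}) \<le> 2" if "v \<in> A \<union> B" for v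
      using assms(3) that unfolding local_colouring_def V by blast
    show "c {u, v} \<in> c ` {e \<in> E. u \<in> e}" if "link A B u v" for u v
      using linkE[OF that] by blast
  qed (use AB assms(1) in auto)
  then obtain k xs where len: "length xs = 2 * m" and xs: "rpath (coloured_link A B c k) xs"
    by (auto simp: mono_path_def)
  have step: "link A B (xs ! i) (xs ! Suc i)" "c {xs ! i, xs ! Suc i} = k" if "Suc i < length xs" for i
    using xs that by (auto simp: rpath_def successively_conv_nth coloured_link_def)
  have "set xs \<subseteq> A \<union> B"
    using step(1) len assms(1) by (intro successively_link_subset) (auto simp: successively_conv_nth)
  moreover have "path_edges xs \<subseteq> E" "\<forall>e\<in>path_edges xs. c e = k"
    using step linkE by (auto simp: path_edges_def)
  moreover have "distinct xs" "xs \<noteq> []"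
    using xs len assms(1) by (auto simp: rpath_def)
  ultimately show ?thesis
    using len by (auto simp: monochromatic_path_def is_path_def V)
qed

end
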